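(* Let $X=(X_{m,n})$ and $Z=(Z_{m,n})$, $0\le m,n\le N$, be the $(N+1)\times(N+1)$ tridiagonal matrices with parameters $\alpha,\beta$ given in the context. The Jacobi matrix $(X+\mu Z)_{m,n}$ is diagonalized by the orthogonal polynomials $\tilde Q_n(y)=\sigma_nQ_n(x,\hat\alpha,\hat\beta,N)$, where $Q_n(x,\hat\alpha,\hat\beta,N)$ are the Hahn polynomials and $$x=y+\alpha+\mu,\qquad \hat\alpha=-1-\mu,\qquad \hat\beta=\beta+\mu-N,\qquad \sigma_n=\frac{(-1)^n(-N)_n}{(\hat\alpha+\hat\beta+N+2)_n}.$$
   Context: $(a)_k=a(a+1)\cdots(a+k-1)$ is the Pochhammer symbol. The Hahn polynomials are $$Q_n(x,\hat\alpha,\hat\beta,N)={}_3F_2\!\left({-n,\,n+\hat\alpha+\hat\beta+1,\,-x\atop \hat\alpha+1,\,-N};1\right),\quad n=0,\dots,N.$$ "Diagonalized" means that the polynomials satisfy the recurrence relation $$y\,\tilde Q_n(y)=(X+\mu Z)_{n+1,n}\tilde Q_{n+1}(y)+(X+\mu Z)_{n,n}\tilde Q_n(y)+(X+\mu Z)_{n-1,n}\tilde Q_{n-1}(y)$$ at the points $y=x-\alpha-\mu$, $x=0,1,\dots,N$ (terms with index $-1$ or $N+1$ being absent). The nonzero entries of $X$ and $Z$ ($n=0,\dots,N$) are $$X_{n+1,n}=\frac{n(\beta+n+1)(N-\beta-n)}{(N-\beta-2n)(N-\beta-2n-1)},\qquad X_{n-1,n}=\frac{n(N-\beta-n)(N-n+1)}{(N-\beta-2n)(N-\beta-2n+1)},$$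 $$X_{n,n}=-\alpha-n+\frac{\beta n(n-1)+n^2(n-1)}{N-\beta-2n+1}-\frac{\beta n(n+1)+n(n+1)^2}{N-\beta-2n-1},$$ $$Z_{n+1,n}=-\frac{(\beta+n+1)(N-\beta-n)}{(N-\beta-2n)(N-\beta-2n-1)},\qquad Z_{n-1,n}=-\frac{n(N-n+1)}{(N-\beta-2n)(N-\beta-2n+1)},$$ $$Z_{n,n}=\frac{(n+1)\beta+(n+1)^2}{N-\beta-2n-1}-\frac{\beta n+n^2}{N-\beta-2n+1},$$ with $X_{N+1,N}=Z_{N+1,N}=0$. Together with the diagonal matrix $V_{n,n}=-n(n-N+\beta)$ they represent the meta-Hahn algebra, in particular $[Z,X]=Z^2+Z$. Here $\alpha,\beta,\mu$ are real parameters. *)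

theory Defs
  imports "HOL-Analysis.FPS_Convergence" "Jordan_Normal_Form.Matrix"
begin

(* The series terminates because of the parameter -n.  For k > N the factor 1 / (-N)_k is 0 by
   division by zero, but for n \<le> N these terms vanish anyway, since (-n)_k = 0 for k > n. *)
definition hahn :: "nat \<Rightarrow> real \<Rightarrow> real \<Rightarrow> real \<Rightarrow> nat \<Rightarrow> real" where
  "hahn n x a b N =
     eval_fps (fps_hypergeo [- real n, real n + a + b + 1, - x] [a + 1, - real N] 1) 1"

(* Row and column indices start at 0; restricting to 0..N makes the entry at (N + 1, N) absent,
   which is the convention that it is zero. *)
definition X_mat :: "real \<Rightarrow> real \<Rightarrow> nat \<Rightarrow> real mat" where
  "X_mat \<alpha> \<beta> N = mat (N + 1) (N + 1) (\<lambda>(i, j).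
     let n = real j; N' = real N in
     if i = j + 1 then
       n * (\<beta> + n + 1) * (N' - \<beta> - n) / ((N' - \<beta> - 2 * n) * (N' - \<beta> - 2 * n - 1))
     else if j = i + 1 then
       n * (N' - \<beta> - n) * (N' - n + 1) / ((N' - \<beta> - 2 * n) * (N' - \<beta> - 2 * n + 1))
     else if i = j then
       - \<alpha> - n + (\<beta> * n * (n - 1) + n\<^sup>2 * (n - 1)) / (N' - \<beta> - 2 * n + 1)
               - (\<beta> * n * (n + 1) + n * (n + 1)\<^sup>2) / (N' - \<beta> - 2 * n - 1)
     else 0)"

definition Z_mat :: "real \<Rightarrow> nat \<Rightarrow> real mat" where
  "Z_mat \<beta> N = mat (N + 1) (N + 1) (\<lambda>(i, j).
     let n = real j; N' = real N in
     if i = j + 1 then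
       - ((\<beta> + n + 1) * (N' - \<beta> - n) / ((N' - \<beta> - 2 * n) * (N' - \<beta> - 2 * n - 1)))
     else if j = i + 1 then
       - (n * (N' - n + 1) / ((N' - \<beta> - 2 * n) * (N' - \<beta> - 2 * n + 1)))
     else if i = j then
       ((n + 1) * \<beta> + (n + 1)\<^sup>2) / (N' - \<beta> - 2 * n - 1)
         - (\<beta> * n + n\<^sup>2) / (N' - \<beta> - 2 * n + 1)
     else 0)"

(* The family P is indexed by 0..N, and the sum in each recurrence runs down column n of J. *)
definition diagonalized_by ::
    "real mat \<Rightarrow> nat \<Rightarrow> (nat \<Rightarrow> real \<Rightarrow> real) \<Rightarrow> real set \<Rightarrow> bool" where
  "diagonalized_by J N P S \<longleftrightarrow>
     (\<forall>n\<le>N. \<forall>y\<in>S.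
        y * P n y = (if n < N then J $$ (n + 1, n) * P (n + 1) y else 0)
                  + J $$ (n, n) * P n y
                  + (if 0 < n then J $$ (n - 1, n) * P (n - 1) y else 0))"

end

theory Submission
  imports Defs
begin

text \<open>
  Multiplication by \<open>-x\<close> acts on the basis \<open>(-x)\<^sub>k\<close> as \<open>(-x) (-x)\<^sub>k = (-x)\<^sub>k\<^sub>+\<^sub>1 - k (-x)\<^sub>k\<close>, so the
  three-term recurrence of the Hahn polynomials is an identity between their coefficients. The degree
  \<open>r\<close> enters these only through \<open>(-r)\<^sub>k (r + a + b + 1)\<^sub>k\<close>, whose first difference in \<open>r\<close> factors and
  which is invariant under \<open>r \<mapsto> -(r + a + b + 1)\<close>; this reflection exchanges the two
  off-diagonal coefficients of the recurrence. At \<open>n = N\<close> the left-over term is a multiple of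
  \<open>(-x)\<^sub>N\<^sub>+\<^sub>1\<close>, which vanishes on the grid \<open>x = 0, \<dots>, N\<close>. The entries of \<open>X + \<mu> Z\<close> are the
  coefficients of this recurrence, conjugated by \<open>\<sigma>\<close> and shifted by \<open>-\<alpha> - \<mu>\<close>.
\<close>

lemma pochhammer_mult_shift_diff:
  fixes a b :: "'a::comm_ring_1"
  shows "pochhammer a (Suc k) * pochhammer (b + 1) (Suc k)
      - pochhammer (a + 1) (Suc k) * pochhammer b (Suc k)
    = of_nat (Suc k) * (a - b) * (pochhammer (a + 1) k * pochhammer (b + 1) k)"
  unfolding pochhammer_rec[of a] pochhammer_rec[of b] pochhammer_Suc[of "_ + 1"]
  by (simp add: algebra_simps)

lemma mult_sum_pochhammer:
  fixes z :: "'a::comm_ring_1"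
  shows "z * (\<Sum>k\<le>N. c k * pochhammer z k)
    = (\<Sum>k<N. (c k - of_nat (Suc k) * c (Suc k)) * pochhammer z (Suc k)) + c N * pochhammer z (Suc N)"
proof (induction N)
  case 0
  show ?case by simp
next
  case (Suc N)
  have "z * pochhammer z (Suc N) = pochhammer z (Suc (Suc N)) - of_nat (Suc N) * pochhammer z (Suc N)"
    by (simp add: pochhammer_Suc[of z "Suc N"] algebra_simps)
  then have "z * (c (Suc N) * pochhammer z (Suc N))
      = c (Suc N) * (pochhammer z (Suc (Suc N)) - of_nat (Suc N) * pochhammer z (Suc N))"
    by (metis mult.left_commute)
  with Suc.IH show ?case
    by (simp add: algebra_simps del: of_nat_Suc)
qed

definition hahn_num :: "'a::comm_ring_1 \<Rightarrow> 'a \<Rightarrow> 'a \<Rightarrow> nat \<Rightarrow> 'a" where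
  "hahn_num a b r k = pochhammer (- r) k * pochhammer (r + a + b + 1) k"

definition hahn_den :: "'a::comm_ring_1 \<Rightarrow> 'a \<Rightarrow> nat \<Rightarrow> 'a" where
  "hahn_den a M k = pochhammer (a + 1) k * pochhammer (- M) k * of_nat (fact k)"

definition hahn_coeff :: "'a::field \<Rightarrow> 'a \<Rightarrow> 'a \<Rightarrow> 'a \<Rightarrow> nat \<Rightarrow> 'a" where
  "hahn_coeff a b M r k = hahn_num a b r k / hahn_den a M k"

definition hahn_sum :: "'a::field \<Rightarrow> 'a \<Rightarrow> 'a \<Rightarrow> nat \<Rightarrow> 'a \<Rightarrow> 'a \<Rightarrow> 'a" where
  "hahn_sum a b M n r z = (\<Sum>k\<le>n. hahn_coeff a b M r k * pochhammer z k)"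

definition hahn_up :: "'a::field \<Rightarrow> 'a \<Rightarrow> 'a \<Rightarrow> 'a \<Rightarrow> 'a" where
  "hahn_up a b M r = (r + a + b + 1) * (r + a + 1) * (M - r) /
     ((2 * r + a + b + 1) * (2 * r + a + b + 2))"

definition hahn_down :: "'a::field \<Rightarrow> 'a \<Rightarrow> 'a \<Rightarrow> 'a \<Rightarrow> 'a" where
  "hahn_down a b M r = r * (r + a + b + M + 1) * (r + b) /
     ((2 * r + a + b) * (2 * r + a + b + 1))"

lemma hahn_up_top [simp]: "hahn_up a b M M = 0"
  by (simp add: hahn_up_def)

lemma hahn_down_0 [simp]: "hahn_down a b M 0 = 0"
  by (simp add: hahn_down_def)

lemma hahn_num_Suc:
  "hahn_num a b r (Suc k) = hahn_num a b r k * ((of_nat k - r) * (r + a + b + 1 + of_nat k))"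
  by (simp add: hahn_num_def pochhammer_Suc algebra_simps)

lemma hahn_den_Suc:
  "hahn_den a M (Suc k) = hahn_den a M k * (of_nat (Suc k) * (a + 1 + of_nat k) * (of_nat k - M))"
  by (simp add: hahn_den_def pochhammer_Suc algebra_simps)

lemma hahn_coeff_0 [simp]: "hahn_coeff a b M r 0 = 1"
  by (simp add: hahn_coeff_def hahn_num_def hahn_den_def)

lemma hahn_num_reflect: "hahn_num a b (- (r + a + b + 1)) k = hahn_num a b r k"
  by (simp add: hahn_num_def algebra_simps)

lemma hahn_down_eq_hahn_up_reflect: "hahn_down a b M r = hahn_up a b M (- (r + a + b + 1))"
proof -
  have "(2 * (- (r + a + b + 1)) + a + b + 1) * (2 * (- (r + a + b + 1)) + a + b + 2)
      = (2 * r + a + b) * (2 * r + a + b + 1)"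
    by (simp add: algebra_simps)
  moreover have "(- (r + a + b + 1) + a + b + 1) * (- (r + a + b + 1) + a + 1) * (M - - (r + a + b + 1))
      = r * (r + a + b + M + 1) * (r + b)"
    by (simp add: algebra_simps)
  ultimately show ?thesis
    by (simp only: hahn_up_def hahn_down_def)
qed

lemma hahn_up_mult_diff:
  fixes a b M r :: "'a::field"
  assumes "r + a + b + 1 = 0 \<or> 2 * r + a + b + 2 \<noteq> 0"
  shows "hahn_up a b M r * (hahn_num a b (r + 1) (Suc k) - hahn_num a b r (Suc k))
    = of_nat (Suc k) * (r + a + 1) * (r - M) * (r + a + b + 1 + of_nat k) / (2 * r + a + b + 1)
        * hahn_num a b r k"
proof -
  define G where "G = pochhammer (- r) k * pochhammer (r + a + b + 2) k"
  have diff: "hahn_num a b (r + 1) (Suc k) - hahn_num a b r (Suc k)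
      = - of_nat (Suc k) * (2 * r + a + b + 2) * G"
    using pochhammer_mult_shift_diff[of "- (r + 1)" k "r + a + b + 1"]
    by (simp add: hahn_num_def G_def algebra_simps del: of_nat_Suc)
  have "(r + a + b + 1) * pochhammer (r + a + b + 2) k
      = pochhammer (r + a + b + 1) k * (r + a + b + 1 + of_nat k)"
    using pochhammer_rec[of "r + a + b + 1" k] by (simp add: pochhammer_Suc add.assoc)
  then have num: "(r + a + b + 1) * G = (r + a + b + 1 + of_nat k) * hahn_num a b r k"
    by (simp add: G_def hahn_num_def mult_ac)
  have "hahn_up a b M r * (2 * r + a + b + 2)
      = - ((r + a + b + 1) * (r + a + 1) * (r - M) / (2 * r + a + b + 1))"
    using assms unfolding hahn_up_def minus_diff_eq[of r M, symmetric]
    by (auto simp: mult_ac simp del: minus_diff_eq)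
  then have "hahn_up a b M r * (hahn_num a b (r + 1) (Suc k) - hahn_num a b r (Suc k))
      = of_nat (Suc k) * (r + a + 1) * (r - M) / (2 * r + a + b + 1) * ((r + a + b + 1) * G)"
    unfolding diff by (simp add: mult_ac del: of_nat_Suc)
  then show ?thesis
    unfolding num by (simp add: mult_ac del: of_nat_Suc)
qed

lemma hahn_down_mult_diff:
  fixes a b M r :: "'a::field"
  assumes "r = 0 \<or> 2 * r + a + b \<noteq> 0"
  shows "hahn_down a b M r * (hahn_num a b (r - 1) (Suc k) - hahn_num a b r (Suc k))
    = of_nat (Suc k) * (r + b) * (r + a + b + M + 1) * (r - of_nat k) / (2 * r + a + b + 1)
        * hahn_num a b r k"
proof -
  define q where "q = - (r + a + b + 1)"
  have reflect: "q + a + b + 1 = - r" "2 * q + a + b + 2 = - (2 * r + a + b)"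
    "2 * q + a + b + 1 = - (2 * r + a + b + 1)" "q + a + 1 = - (r + b)" "q - M = - (r + a + b + M + 1)"
    by (simp_all add: q_def algebra_simps)
  have signs: "s * - x * - y * (- r + of_nat k) / - d = s * x * y * (r - of_nat k) / d" for s x y d
    by (simp add: right_diff_distrib diff_divide_distrib)
  have "hahn_num a b (q + 1) (Suc k) = hahn_num a b (r - 1) (Suc k)"
    using hahn_num_reflect[of a b "r - 1" "Suc k"] by (simp add: q_def algebra_simps)
  moreover have "hahn_num a b q i = hahn_num a b r i" for i
    by (simp only: q_def hahn_num_reflect)
  moreover have "q + a + b + 1 = 0 \<or> 2 * q + a + b + 2 \<noteq> 0"
    using assms by (simp only: reflect neg_equal_0_iff_equal)
  ultimately show ?thesis
    using hahn_up_mult_diff[of q a b M k]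
    unfolding hahn_down_eq_hahn_up_reflect q_def[symmetric] reflect signs by simp
qed

lemma hahn_num_recurrence:
  fixes a b M r :: "'a::field"
  assumes "2 * r + a + b + 1 \<noteq> 0"
    and "r + a + b + 1 = 0 \<or> 2 * r + a + b + 2 \<noteq> 0"
    and "r = 0 \<or> 2 * r + a + b \<noteq> 0"
  shows "of_nat (Suc k) * ((a + 1 + of_nat k) * (of_nat k - M) * hahn_num a b r k
      - hahn_num a b r (Suc k))
    = hahn_up a b M r * (hahn_num a b (r + 1) (Suc k) - hahn_num a b r (Suc k))
    + hahn_down a b M r * (hahn_num a b (r - 1) (Suc k) - hahn_num a b r (Suc k))"
proof -
  define K :: 'a where "K = of_nat k"
  \<comment> \<open>Both sides are affine in \<open>K\<close>: compare them at \<open>K = r\<close> and \<open>K = -(r + a + b + 1)\<close>.\<close>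
  have "((a + 1 + K) * (K - M) - (K - r) * (r + a + b + 1 + K)) * (2 * r + a + b + 1)
      = (r + b) * (r + a + b + M + 1) * (r - K) + (r + a + 1) * (r - M) * (r + a + b + 1 + K)"
    by (simp add: algebra_simps)
  then have "(a + 1 + K) * (K - M) - (K - r) * (r + a + b + 1 + K)
      = (r + b) * (r + a + b + M + 1) * (r - K) / (2 * r + a + b + 1)
      + (r + a + 1) * (r - M) * (r + a + b + 1 + K) / (2 * r + a + b + 1)"
    by (simp only: nonzero_eq_divide_eq[OF assms(1)] flip: add_divide_distrib)
  from arg_cong[OF this, of "\<lambda>t. of_nat (Suc k) * t * hahn_num a b r k"]
  show ?thesis
    unfolding hahn_up_mult_diff[OF assms(2)] hahn_down_mult_diff[OF assms(3)]
    unfolding hahn_num_Suc K_def[symmetric]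
    by (simp add: algebra_simps del: of_nat_Suc)
qed

lemma hahn_coeff_recurrence:
  fixes a b M r :: "'a::field"
  assumes "2 * r + a + b + 1 \<noteq> 0"
    and "r + a + b + 1 = 0 \<or> 2 * r + a + b + 2 \<noteq> 0"
    and "r = 0 \<or> 2 * r + a + b \<noteq> 0"
    and den: "hahn_den a M (Suc k) \<noteq> 0"
  shows "hahn_coeff a b M r k - of_nat (Suc k) * hahn_coeff a b M r (Suc k)
    = hahn_up a b M r * (hahn_coeff a b M (r + 1) (Suc k) - hahn_coeff a b M r (Suc k))
    + hahn_down a b M r * (hahn_coeff a b M (r - 1) (Suc k) - hahn_coeff a b M r (Suc k))"
proof -
  have "hahn_coeff a b M r k
      = hahn_num a b r k * (of_nat (Suc k) * (a + 1 + of_nat k) * (of_nat k - M)) / hahn_den a M (Suc k)"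
    using den unfolding hahn_coeff_def hahn_den_Suc by (simp del: of_nat_Suc)
  then have "hahn_coeff a b M r k - of_nat (Suc k) * hahn_coeff a b M r (Suc k)
      = of_nat (Suc k) * ((a + 1 + of_nat k) * (of_nat k - M) * hahn_num a b r k
          - hahn_num a b r (Suc k)) / hahn_den a M (Suc k)"
    by (simp add: hahn_coeff_def right_diff_distrib diff_divide_distrib mult_ac del: of_nat_Suc)
  then show ?thesis
    unfolding hahn_num_recurrence[OF assms(1-3)]
    by (simp add: hahn_coeff_def add_divide_distrib diff_divide_distrib right_diff_distrib)
qed

lemma hahn_sum_recurrence:
  fixes a b M r z :: "'a::field"
  assumes "n = 0 \<or> 2 * r + a + b + 1 \<noteq> 0"
    and "r + a + b + 1 = 0 \<or> 2 * r + a + b + 2 \<noteq> 0"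
    and "r = 0 \<or> 2 * r + a + b \<noteq> 0"
    and "\<And>k. 0 < k \<Longrightarrow> k \<le> n \<Longrightarrow> hahn_den a M k \<noteq> 0"
  shows "z * hahn_sum a b M n r z
    = hahn_up a b M r * (hahn_sum a b M n (r + 1) z - hahn_sum a b M n r z)
    + hahn_down a b M r * (hahn_sum a b M n (r - 1) z - hahn_sum a b M n r z)
    + hahn_coeff a b M r n * pochhammer z (Suc n)"
proof -
  define c where "c = hahn_coeff a b M"
  define rhs where "rhs k = hahn_up a b M r * (c (r + 1) k - c r k)
    + hahn_down a b M r * (c (r - 1) k - c r k)" for k
  have "z * hahn_sum a b M n r z
      = (\<Sum>k<n. (c r k - of_nat (Suc k) * c r (Suc k)) * pochhammer z (Suc k))
        + c r n * pochhammer z (Suc n)"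
    by (simp only: hahn_sum_def c_def mult_sum_pochhammer)
  also have "(\<Sum>k<n. (c r k - of_nat (Suc k) * c r (Suc k)) * pochhammer z (Suc k))
      = (\<Sum>k<n. rhs (Suc k) * pochhammer z (Suc k))"
  proof (rule sum.cong)
    fix k assume "k \<in> {..<n}"
    then show "(c r k - of_nat (Suc k) * c r (Suc k)) * pochhammer z (Suc k)
        = rhs (Suc k) * pochhammer z (Suc k)"
      using hahn_coeff_recurrence[of r a b M k] assms by (auto simp: c_def rhs_def)
  qed simp
  also have "\<dots> = (\<Sum>k\<le>n. rhs k * pochhammer z k)"
    using sum.lessThan_Suc_shift[of "\<lambda>k. rhs k * pochhammer z k" n]
    by (simp add: rhs_def c_def lessThan_Suc_atMost)
  also have "\<dots> = hahn_up a b M r * (hahn_sum a b M n (r + 1) z - hahn_sum a b M n r z)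
      + hahn_down a b M r * (hahn_sum a b M n (r - 1) z - hahn_sum a b M n r z)"
    by (simp add: hahn_sum_def rhs_def c_def sum_distrib_left algebra_simps sum.distrib sum_subtractf)
  finally show ?thesis
    by (simp only: c_def)
qed

lemma hahn_eq_hahn_sum: "hahn n x a b N = hahn_sum a b (real N) N (real n) (- x)"
proof -
  define c where "c k = hahn_coeff a b (real N) (real n) k * pochhammer (- x) k" for k
  have nth: "fps_nth (fps_hypergeo [- real n, real n + a + b + 1, - x] [a + 1, - real N] 1) k = c k"
    for k
    by (simp add: c_def hahn_coeff_def hahn_num_def hahn_den_def foldl_mult_start)
  \<comment> \<open>Also for \<open>n > N\<close> the series stops at \<open>k = N\<close>, because of the division by \<open>(-N)\<^sub>k = 0\<close>.\<close>
  have "c k = 0" if "k \<notin> {..N}" for k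
    using that by (simp add: c_def hahn_coeff_def hahn_den_def pochhammer_of_nat_eq_0_lemma)
  then have "(\<Sum>k. c k) = (\<Sum>k\<le>N. c k)"
    by (intro suminf_finite) auto
  then show ?thesis
    by (simp only: hahn_def eval_fps_def nth power_one mult_1_right hahn_sum_def c_def)
qed

lemma hahn_recurrence:
  fixes a b x :: real
  assumes "N = 0 \<or> 2 * real n + a + b + 1 \<noteq> 0" "2 * real n + a + b + 2 \<noteq> 0"
      "n = 0 \<or> 2 * real n + a + b \<noteq> 0"
    and den: "pochhammer (a + 1) N \<noteq> 0"
    and top: "n < N \<or> pochhammer (- x) (Suc N) = 0"
  shows "- x * hahn n x a b N = hahn_up a b N n * hahn (n + 1) x a b N
    - (hahn_up a b N n + hahn_down a b N n) * hahn n x a b N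
    + hahn_down a b N n * hahn (n - 1) x a b N"
proof -
  define S where "S r = hahn_sum a b (real N) N r (- x)" for r
  have "hahn_den a (real N) k \<noteq> 0" if "k \<le> N" for k
    using den that pochhammer_eq_0_mono[of "a + 1" k N]
    by (auto simp: hahn_den_def pochhammer_of_nat_eq_0_iff)
  then have "- x * S n = hahn_up a b N n * (S (real n + 1) - S n)
      + hahn_down a b N n * (S (real n - 1) - S n)
      + hahn_coeff a b N n N * pochhammer (- x) (Suc N)"
    unfolding S_def using assms by (intro hahn_sum_recurrence) auto
  also have "hahn_coeff a b N n N * pochhammer (- x) (Suc N) = 0"
    using top by (auto simp: hahn_coeff_def hahn_num_def pochhammer_of_nat_eq_0_lemma)
  also have "hahn_down a b N n * (S (real n - 1) - S n)
      = hahn_down a b N n * (S (real (n - 1)) - S n)"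
    by (cases n) simp_all
  also have "S (real n + 1) = S (real (n + 1))"
    by (simp add: add.commute)
  finally show ?thesis
    unfolding S_def hahn_eq_hahn_sum by (simp add: algebra_simps)
qed

lemma diagonalized_by_rescale:
  assumes rec: "\<And>n x. n \<le> N \<Longrightarrow> x \<in> S \<Longrightarrow>
      - x * h n x = A n * h (n + 1) x - (A n + C n) * h n x + C n * h (n - 1) x"
    and ends: "A N = 0" "C 0 = 0"
    and sub: "\<And>n. n < N \<Longrightarrow> J $$ (Suc n, n) * \<sigma> (Suc n) = - A n * \<sigma> n"
    and diag: "\<And>n. n \<le> N \<Longrightarrow> J $$ (n, n) = A n + C n + t"
    and super: "\<And>n. n < N \<Longrightarrow> J $$ (n, Suc n) * \<sigma> n = - C (Suc n) * \<sigma> (Suc n)"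
    and P: "\<And>n x. n \<le> N \<Longrightarrow> x \<in> S \<Longrightarrow> P n (x + t) = \<sigma> n * h n x"
  shows "diagonalized_by J N P ((\<lambda>x. x + t) ` S)"
  unfolding diagonalized_by_def
proof (intro allI impI ballI, elim imageE)
  fix n x y
  assume n: "n \<le> N" and x: "x \<in> S" and y: "y = x + t"
  have sub_term: "(if n < N then J $$ (n + 1, n) * P (n + 1) y else 0) = - A n * \<sigma> n * h (n + 1) x"
    using sub[of n] P[of "n + 1" x] ends n x by (auto simp: y simp flip: mult.assoc)
  have super_term: "(if 0 < n then J $$ (n - 1, n) * P (n - 1) y else 0) = - C n * \<sigma> n * h (n - 1) x"
    using super[of "n - 1"] P[of "n - 1" x] ends n x by (cases n) (auto simp: y simp flip: mult.assoc)
  have "y * P n y = - \<sigma> n * (- x * h n x) + t * (\<sigma> n * h n x)"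
    using P[OF n x] by (simp add: y algebra_simps)
  also have "\<dots> = - A n * \<sigma> n * h (n + 1) x + (A n + C n + t) * (\<sigma> n * h n x) - C n * \<sigma> n * h (n - 1) x"
    unfolding rec[OF n x] by (simp add: algebra_simps)
  finally show "y * P n y = (if n < N then J $$ (n + 1, n) * P (n + 1) y else 0)
      + J $$ (n, n) * P n y + (if 0 < n then J $$ (n - 1, n) * P (n - 1) y else 0)"
    using P[OF n x] unfolding sub_term super_term diag[OF n] by (simp add: y)
qed

definition hahn_scale :: "'a::field \<Rightarrow> 'a \<Rightarrow> nat \<Rightarrow> 'a" where
  "hahn_scale c M n = (- 1) ^ n * pochhammer (- M) n / pochhammer c n"

lemma hahn_scale_Suc:
  assumes "c + of_nat n \<noteq> 0"
  shows "(c + of_nat n) * hahn_scale c M (Suc n) = (M - of_nat n) * hahn_scale c M n"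
  using assms by (simp add: hahn_scale_def pochhammer_Suc left_diff_distrib right_diff_distrib
      diff_divide_distrib mult_ac)

definition jacobi_mat :: "real \<Rightarrow> real \<Rightarrow> real \<Rightarrow> nat \<Rightarrow> real mat" where
  "jacobi_mat \<alpha> \<beta> \<mu> N = X_mat \<alpha> \<beta> N + \<mu> \<cdot>\<^sub>m Z_mat \<beta> N"

lemma jacobi_mat_nth:
  "i \<le> N \<Longrightarrow> j \<le> N \<Longrightarrow> jacobi_mat \<alpha> \<beta> \<mu> N $$ (i, j) = X_mat \<alpha> \<beta> N $$ (i, j) + \<mu> * Z_mat \<beta> N $$ (i, j)"
  by (simp add: jacobi_mat_def Z_mat_def)

lemma jacobi_mat_sub_mult_scale:
  assumes "n < N" and "\<beta> + 1 + real n \<noteq> 0"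
  shows "jacobi_mat \<alpha> \<beta> \<mu> N $$ (Suc n, n) * hahn_scale (\<beta> + 1) (real N) (Suc n)
    = - hahn_up (- 1 - \<mu>) (\<beta> + \<mu> - real N) (real N) (real n) * hahn_scale (\<beta> + 1) (real N) n"
proof -
  define p where "p = (real N - \<beta> - 2 * real n) * (real N - \<beta> - 2 * real n - 1)"
  define s where "s = hahn_scale (\<beta> + 1) (real N)"
  have "jacobi_mat \<alpha> \<beta> \<mu> N $$ (Suc n, n)
      = real n * (\<beta> + real n + 1) * (real N - \<beta> - real n) / p
        + \<mu> * (- ((\<beta> + real n + 1) * (real N - \<beta> - real n) / p))"
    using assms(1) by (simp add: jacobi_mat_nth X_mat_def Z_mat_def Let_def p_def)
  also have "\<dots> = (real n - \<mu>) * (real N - \<beta> - real n) / p * (\<beta> + 1 + real n)"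
    by (simp add: algebra_simps flip: diff_divide_distrib)
  finally have "jacobi_mat \<alpha> \<beta> \<mu> N $$ (Suc n, n) * s (Suc n)
      = (real n - \<mu>) * (real N - \<beta> - real n) / p * ((\<beta> + 1 + real n) * s (Suc n))"
    by (simp only: mult.assoc)
  also have "\<dots> = (real n - \<mu>) * (real N - \<beta> - real n) / p * ((real N - real n) * s n)"
    using hahn_scale_Suc[OF assms(2)] by (simp only: s_def)
  also have "\<dots> = (real n - \<mu>) * (real N - \<beta> - real n) * (real N - real n) / p * s n"
    by simp
  also have "(real n - \<mu>) * (real N - \<beta> - real n) * (real N - real n) / p
      = - hahn_up (- 1 - \<mu>) (\<beta> + \<mu> - real N) (real N) (real n)"
    unfolding hahn_up_def p_def minus_divide_left
    by (rule arg_cong2[where f = "(/)"]) (simp_all add: algebra_simps)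
  finally show ?thesis
    by (simp only: s_def)
qed

lemma jacobi_mat_super_mult_scale:
  assumes "n < N" and "\<beta> + 1 + real n \<noteq> 0"
  shows "jacobi_mat \<alpha> \<beta> \<mu> N $$ (n, Suc n) * hahn_scale (\<beta> + 1) (real N) n
    = - hahn_down (- 1 - \<mu>) (\<beta> + \<mu> - real N) (real N) (real (Suc n))
        * hahn_scale (\<beta> + 1) (real N) (Suc n)"
proof -
  define r where "r = real (Suc n)"
  define p where "p = (real N - \<beta> - 2 * r) * (real N - \<beta> - 2 * r + 1)"
  define s where "s = hahn_scale (\<beta> + 1) (real N)"
  have "jacobi_mat \<alpha> \<beta> \<mu> N $$ (n, Suc n)
      = r * (real N - \<beta> - r) * (real N - r + 1) / p + \<mu> * (- (r * (real N - r + 1) / p))"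
    using assms(1)
    by (simp add: jacobi_mat_nth X_mat_def Z_mat_def Let_def p_def r_def del: of_nat_Suc)
  also have "\<dots> = r * (real N - \<beta> - r - \<mu>) / p * (real N - r + 1)"
    by (simp add: algebra_simps flip: diff_divide_distrib)
  finally have "jacobi_mat \<alpha> \<beta> \<mu> N $$ (n, Suc n) * s n
      = r * (real N - \<beta> - r - \<mu>) / p * ((real N - real n) * s n)"
    by (simp add: r_def)
  also have "\<dots> = r * (real N - \<beta> - r - \<mu>) / p * ((\<beta> + 1 + real n) * s (Suc n))"
    using hahn_scale_Suc[OF assms(2)] by (simp only: s_def)
  also have "\<dots> = r * (real N - \<beta> - r - \<mu>) * (\<beta> + r) / p * s (Suc n)"
    by (simp add: r_def add_ac)
  also have "r * (real N - \<beta> - r - \<mu>) * (\<beta> + r) / p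
      = - hahn_down (- 1 - \<mu>) (\<beta> + \<mu> - real N) (real N) r"
    unfolding hahn_down_def p_def minus_divide_left
    by (rule arg_cong2[where f = "(/)"]) (simp_all add: algebra_simps)
  finally show ?thesis
    by (simp only: s_def r_def)
qed

lemma jacobi_mat_diag:
  assumes "n \<le> N"
    and nz: "N = 0 \<or> real N - \<beta> - 2 * real n \<noteq> 0" "real N - \<beta> - 2 * real n - 1 \<noteq> 0"
      "n = 0 \<or> real N - \<beta> - 2 * real n + 1 \<noteq> 0"
  shows "jacobi_mat \<alpha> \<beta> \<mu> N $$ (n, n)
    = hahn_up (- 1 - \<mu>) (\<beta> + \<mu> - real N) (real N) (real n)
    + hahn_down (- 1 - \<mu>) (\<beta> + \<mu> - real N) (real N) (real n) - \<alpha> - \<mu>"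
proof -
  define r where "r = real n"
  define p where "p = real N - \<beta> - 2 * r"
  have N: "real N = p + \<beta> + 2 * r"
    by (simp add: p_def)
  have "jacobi_mat \<alpha> \<beta> \<mu> N $$ (n, n)
      = - \<alpha> - r + (\<beta> * r * (r - 1) + r\<^sup>2 * (r - 1)) / (p + 1)
        - (\<beta> * r * (r + 1) + r * (r + 1)\<^sup>2) / (p - 1)
        + \<mu> * (((r + 1) * \<beta> + (r + 1)\<^sup>2) / (p - 1) - (\<beta> * r + r\<^sup>2) / (p + 1))"
    using assms(1) by (simp add: jacobi_mat_nth X_mat_def Z_mat_def Let_def r_def p_def)
  also have "\<dots> = - (p + r) * (r - \<mu>) * (p + \<beta> + r) / (p * (p - 1))
      + r * (\<mu> - p - r) * (r + \<beta>) / (p * (p + 1)) - \<alpha> - \<mu>"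
  proof (cases "n = 0")
    case True
    then show ?thesis
      using nz by (auto simp: r_def p_def divide_simps) (simp_all add: algebra_simps)
  next
    case False
    then have "p \<noteq> 0" "p - 1 \<noteq> 0" "p + 1 \<noteq> 0"
      using assms by (auto simp: p_def r_def)
    then show ?thesis
      by (simp add: divide_simps) (simp add: algebra_simps power2_eq_square)
  qed
  also have "- (p + r) * (r - \<mu>) * (p + \<beta> + r) / (p * (p - 1))
      = hahn_up (- 1 - \<mu>) (\<beta> + \<mu> - real N) (real N) r"
    by (simp add: hahn_up_def N algebra_simps)
  also have "r * (\<mu> - p - r) * (r + \<beta>) / (p * (p + 1))
      = hahn_down (- 1 - \<mu>) (\<beta> + \<mu> - real N) (real N) r"
    by (simp add: hahn_down_def N algebra_simps)
  finally show ?thesis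
    by (simp only: r_def)
qed

theorem proposition4p8:
  fixes N :: nat and \<alpha> \<beta> \<mu> \<alpha>' \<beta>' :: real
    and \<sigma> :: "nat \<Rightarrow> real" and Q :: "nat \<Rightarrow> real \<Rightarrow> real"
  assumes sub: "\<And>n. n < N \<Longrightarrow>
      (real N - \<beta> - 2 * real n) * (real N - \<beta> - 2 * real n - 1) \<noteq> 0"
    and super: "\<And>n. 0 < n \<Longrightarrow> n \<le> N \<Longrightarrow>
      (real N - \<beta> - 2 * real n) * (real N - \<beta> - 2 * real n + 1) \<noteq> 0"
    and diag: "\<And>n. n \<le> N \<Longrightarrow> real N - \<beta> - 2 * real n - 1 \<noteq> 0"
    and \<alpha>': "\<alpha>' = - 1 - \<mu>"
    and \<beta>': "\<beta>' = \<beta> + \<mu> - real N"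
    and hahn_denom: "\<And>k. k \<le> N \<Longrightarrow> pochhammer (\<alpha>' + 1) k \<noteq> 0"
    and \<sigma>_denom: "\<And>n. n \<le> N \<Longrightarrow> pochhammer (\<alpha>' + \<beta>' + real N + 2) n \<noteq> 0"
    and \<sigma>: "\<And>n. n \<le> N \<Longrightarrow>
      \<sigma> n = (- 1) ^ n * pochhammer (- real N) n / pochhammer (\<alpha>' + \<beta>' + real N + 2) n"
    and Q: "\<And>n y. n \<le> N \<Longrightarrow> Q n y = \<sigma> n * hahn n (y + \<alpha> + \<mu>) \<alpha>' \<beta>' N"
  shows "diagonalized_by (X_mat \<alpha> \<beta> N + \<mu> \<cdot>\<^sub>m Z_mat \<beta> N) N Q
           {real x - \<alpha> - \<mu> | x. x \<le> N}"
proof -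
  define A C where "A n = hahn_up \<alpha>' \<beta>' (real N) (real n)"
    and "C n = hahn_down \<alpha>' \<beta>' (real N) (real n)" for n
  note params = A_def C_def \<alpha>' \<beta>'
  have nz: "N = 0 \<or> real N - \<beta> - 2 * real n \<noteq> 0" "real N - \<beta> - 2 * real n - 1 \<noteq> 0"
      "n = 0 \<or> real N - \<beta> - 2 * real n + 1 \<noteq> 0" if "n \<le> N" for n
    using sub[of n] super[of n] diag[of n] that by (cases "n = 0"; auto)+
  have scale: "\<sigma> n = hahn_scale (\<beta> + 1) (real N) n" if "n \<le> N" for n
    using \<sigma>[OF that] by (simp add: hahn_scale_def \<alpha>' \<beta>' add.commute)
  have \<beta>_nz: "\<beta> + 1 + real n \<noteq> 0" if "n < N" for n
    using \<sigma>_denom[of "Suc n"] that by (simp add: \<alpha>' \<beta>' pochhammer_Suc add_ac)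
  have rec: "- x * hahn n x \<alpha>' \<beta>' N = A n * hahn (n + 1) x \<alpha>' \<beta>' N
      - (A n + C n) * hahn n x \<alpha>' \<beta>' N + C n * hahn (n - 1) x \<alpha>' \<beta>' N"
    if "n \<le> N" "x \<in> real ` {..N}" for n x
    unfolding A_def C_def using nz[of n] hahn_denom[of N] that
    by (intro hahn_recurrence) (auto simp: \<alpha>' \<beta>' pochhammer_of_nat_eq_0_lemma)
  have grid: "{real x - \<alpha> - \<mu> | x. x \<le> N} = (\<lambda>x. x + (- \<alpha> - \<mu>)) ` real ` {..N}"
    by (auto simp: image_iff)
  show ?thesis
    using jacobi_mat_sub_mult_scale[OF _ \<beta>_nz] jacobi_mat_super_mult_scale[OF _ \<beta>_nz]
      jacobi_mat_diag[OF _ nz]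
    unfolding grid jacobi_mat_def[symmetric]
    by (intro diagonalized_by_rescale[OF rec, where \<sigma> = \<sigma>]) (simp_all add: params Q scale)
qed

end
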